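(* Let $\mathcal T$ be a basic theory and $\zeta\Rightarrow_r\eta$ a graded implication. If $\mathcal T\vdash\zeta\Rightarrow_r\eta$ in the calculus $\mathbf{LAE}$, then there is a forest proof of $\zeta\Rightarrow_r\eta$ from $\mathcal T$.
   Context: Boolean formulas are built from countably many variables and $\bot,\top$ via $\wedge,\vee,\neg$; $\alpha,\beta$ are Boolean equivalent if $\alpha\to\beta$ and $\beta\to\alpha$ are classical tautologies. A graded implication is $\alpha\Rightarrow_d\beta$, $d\in\mathbb R^+=[0,\infty)$. The calculus $\mathbf{LAE}$ has rules ($c,d\in\mathbb R^+$): (R1) $\alpha\Rightarrow_0\beta$ whenever $\alpha\to\beta$ is a classical tautology; (R2) from $\alpha\Rightarrow_0\beta$ infer $\alpha\wedge\gamma\Rightarrow_0\beta\wedge\gamma$; (R3) from $\alpha\Rightarrow_c\beta$ infer $\alpha\Rightarrow_d\beta$ for $d\ge c$; (R4) from $\alpha\Rightarrow_c\bot$ infer $\alpha\Rightarrow_0\bot$; (R5) from $\alpha\Rightarrow_c\gamma$ and $\beta\Rightarrow_c\gamma$ infer $\alpha\vee\beta\Rightarrow_c\gamma$; (R6) from $\alpha\Rightarrow_c\beta$ and $\beta\Rightarrow_d\gamma$ infer $\alpha\Rightarrow_{c+d}\gamma$. $\mathcal T\vdash\Phi$ means there is a finite sequence ending in $\Phi$ each member of which is in $\mathcal T$ or follows from earlier members by a rule. A literal is $\phi$ or $\neg\phi$ for a variable $\phi$; a clause is a finite set of literals, inconsistent if it contains some $\phi$ and $\neg\phi$, consistent otherwise;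 a clause set is a finite set of clauses. For a clause set $B$, $f(B)=\bigvee_{L\in B}\bigwedge L$ (empty conjunction $=\top$, empty disjunction $=\bot$); $B$ is a clause set for $\alpha$ if $f(B)$ is Boolean equivalent to $\alpha$. A basic implication is $\lambda_1\wedge\dots\wedge\lambda_n\Rightarrow_d\bigvee_{i=1}^l\bigwedge_{j=1}^{k_i}\mu_{ij}$ with $n\ge1$, $l\ge0$, $k_i\ge1$, where $\{\lambda_1,\dots,\lambda_n\}$ and all $\{\mu_{i1},\dots,\mu_{ik_i}\}$ are consistent clauses; a basic theory is a set of basic implications. A proof forest is a finite directed forest (each component a rooted tree, edges directed from father to child) with a weight in $\mathbb R^+$ on each edge, each node labelled by a clause or by the symbol $\divideontimes$ (nodes identified with labels). A branch is a maximal root-to-leaf path; its length is $0$ if it contains $\divideontimes$ and otherwise the sum of its edge weights; the length of the forest is the maximum length of its branches. A forest proof of $\zeta\Rightarrow_r\eta$ from a basic theory $\mathcal T$ is a proof forest such that: (T1) there is a clause set $B_\zeta$ for $\zeta$ such that each clause of $B_\zeta$ has a root that is a subset of it; (T2) there is a clause set $B_\eta$ for $\eta$ such that every terminal clause includes some clause of $B_\eta$; (T3) the length of the forest is at most $r$; (T4) for every non-terminal clause $L$, all edges from $L$ have the same weight $c$, and one of: (A) $c=0$ and $\mathcal T$ contains a basic implication $\lambda_1\wedge\dots\wedge\lambda_n\Rightarrow_0\bigvee_{i=1}^l\bigwedge_j\mu_{ij}$ with $\{\lambda_1,\dots,\lambda_n\}\subseteq L$ such that for each $i$ some child of $L$ is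 a clause $L'\subseteq\{\mu_{i1},\dots,\mu_{ik_i}\}\cup L$; (B) $c>0$ and $\mathcal T$ contains a basic implication $\lambda_1\wedge\dots\wedge\lambda_n\Rightarrow_c\bigvee_{i=1}^l\bigwedge_j\mu_{ij}$ with $\{\lambda_1,\dots,\lambda_n\}\subseteq L$ such that for each $i$ some child of $L$ is a clause $L'\subseteq\{\mu_{i1},\dots,\mu_{ik_i}\}$; (C) $c=0$, $L$ is inconsistent and $\divideontimes$ is the only child of $L$; (D) $c=0$ and for some variable $\phi$, $L$ has exactly two children, one consisting of $\phi$ together with a subset of $L$, the other of $\neg\phi$ together with a subset of $L$. *)

theory Defs
  imports Complex_Main
begin

datatype form =
    Var nat
  | Bot
  | Top
  | And form form
  | Or form form
  | Not form

abbreviation Imp :: "form \<Rightarrow> form \<Rightarrow> form" where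
  "Imp \<alpha> \<beta> \<equiv> Or (Not \<alpha>) \<beta>"

primrec eval :: "(nat \<Rightarrow> bool) \<Rightarrow> form \<Rightarrow> bool" where
  "eval v (Var p) \<longleftrightarrow> v p"
| "eval v Bot \<longleftrightarrow> False"
| "eval v Top \<longleftrightarrow> True"
| "eval v (And \<alpha> \<beta>) \<longleftrightarrow> eval v \<alpha> \<and> eval v \<beta>"
| "eval v (Or \<alpha> \<beta>) \<longleftrightarrow> eval v \<alpha> \<or> eval v \<beta>"
| "eval v (Not \<alpha>) \<longleftrightarrow> \<not> eval v \<alpha>"

definition tautology :: "form \<Rightarrow> bool" where
  "tautology \<alpha> \<longleftrightarrow> (\<forall>v. eval v \<alpha>)"

definition bool_equiv :: "form \<Rightarrow> form \<Rightarrow> bool" where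
  "bool_equiv \<alpha> \<beta> \<longleftrightarrow> tautology (Imp \<alpha> \<beta>) \<and> tautology (Imp \<beta> \<alpha>)"

text \<open>\<open>GImp \<alpha> d \<beta>\<close> stands for the graded implication of \<open>\<beta>\<close> by \<open>\<alpha>\<close> to the degree \<open>d\<close>. Degrees are
  nonnegative reals; this is imposed by side conditions rather than by the type.\<close>

datatype gimp = GImp form real form

text \<open>\<open>lae_rule P \<Phi>\<close>: the graded implication \<open>\<Phi>\<close> follows by a single rule application from premises
  in \<open>P\<close>.\<close>

inductive lae_rule :: "gimp set \<Rightarrow> gimp \<Rightarrow> bool" for P :: "gimp set" where
  R1: "tautology (Imp \<alpha> \<beta>) \<Longrightarrow> lae_rule P (GImp \<alpha> 0 \<beta>)"
| R2: "GImp \<alpha> 0 \<beta> \<in> P \<Longrightarrow> lae_rule P (GImp (And \<alpha> \<gamma>) 0 (And \<beta> \<gamma>))"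
| R3: "GImp \<alpha> c \<beta> \<in> P \<Longrightarrow> 0 \<le> c \<Longrightarrow> c \<le> d \<Longrightarrow> lae_rule P (GImp \<alpha> d \<beta>)"
| R4: "GImp \<alpha> c Bot \<in> P \<Longrightarrow> 0 \<le> c \<Longrightarrow> lae_rule P (GImp \<alpha> 0 Bot)"
| R5: "GImp \<alpha> c \<gamma> \<in> P \<Longrightarrow> GImp \<beta> c \<gamma> \<in> P \<Longrightarrow> 0 \<le> c \<Longrightarrow> lae_rule P (GImp (Or \<alpha> \<beta>) c \<gamma>)"
| R6: "GImp \<alpha> c \<beta> \<in> P \<Longrightarrow> GImp \<beta> d \<gamma> \<in> P \<Longrightarrow> 0 \<le> c \<Longrightarrow> 0 \<le> d \<Longrightarrow>
         lae_rule P (GImp \<alpha> (c + d) \<gamma>)"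

definition lae_proof :: "gimp set \<Rightarrow> gimp list \<Rightarrow> bool" where
  "lae_proof T \<Phi>s \<longleftrightarrow>
     (\<forall>i < length \<Phi>s. \<Phi>s ! i \<in> T \<or> lae_rule (set (take i \<Phi>s)) (\<Phi>s ! i))"

definition lae_provable :: "gimp set \<Rightarrow> gimp \<Rightarrow> bool" (infix "\<turnstile>" 50) where
  "T \<turnstile> \<Phi> \<longleftrightarrow> (\<exists>\<Phi>s. \<Phi>s \<noteq> [] \<and> last \<Phi>s = \<Phi> \<and> lae_proof T \<Phi>s)"

datatype literal = Pos nat | Neg nat

primrec lit_form :: "literal \<Rightarrow> form" where
  "lit_form (Pos p) = Var p"
| "lit_form (Neg p) = Not (Var p)"

type_synonym clause = "literal set"

definition is_clause :: "clause \<Rightarrow> bool" where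
  "is_clause L \<longleftrightarrow> finite L"

definition inconsistent :: "clause \<Rightarrow> bool" where
  "inconsistent L \<longleftrightarrow> (\<exists>p. Pos p \<in> L \<and> Neg p \<in> L)"

definition is_clause_set :: "clause set \<Rightarrow> bool" where
  "is_clause_set B \<longleftrightarrow> finite B \<and> (\<forall>L \<in> B. is_clause L)"

text \<open>Iterated conjunctions and disjunctions are bracketed to the right; a one-element conjunction
  or disjunction is its only member.\<close>

fun conj_list :: "form list \<Rightarrow> form" where
  "conj_list [] = Top"
| "conj_list [\<alpha>] = \<alpha>"
| "conj_list (\<alpha> # \<beta> # \<gamma>s) = And \<alpha> (conj_list (\<beta> # \<gamma>s))"

fun disj_list :: "form list \<Rightarrow> form" where
  "disj_list [] = Bot"
| "disj_list [\<alpha>] = \<alpha>"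
| "disj_list (\<alpha> # \<beta> # \<gamma>s) = Or \<alpha> (disj_list (\<beta> # \<gamma>s))"

text \<open>The conjunctions and disjunctions over finite sets are taken in an arbitrary but fixed order;
  up to Boolean equivalence the order is irrelevant.\<close>

definition enum_set :: "'a set \<Rightarrow> 'a list" where
  "enum_set A = (SOME xs. set xs = A \<and> distinct xs)"

definition clause_form :: "clause \<Rightarrow> form" where
  "clause_form L = conj_list (map lit_form (enum_set L))"

definition clause_set_form :: "clause set \<Rightarrow> form" where
  "clause_set_form B = disj_list (map clause_form (enum_set B))"

definition clause_set_for :: "clause set \<Rightarrow> form \<Rightarrow> bool" where
  "clause_set_for B \<alpha> \<longleftrightarrow> is_clause_set B \<and> bool_equiv (clause_set_form B) \<alpha>"

definition basic_gimp :: "literal list \<Rightarrow> real \<Rightarrow> literal list list \<Rightarrow> gimp" where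
  "basic_gimp ls d mss =
     GImp (conj_list (map lit_form ls)) d
          (disj_list (map (\<lambda>ms. conj_list (map lit_form ms)) mss))"

definition basic_data :: "literal list \<Rightarrow> real \<Rightarrow> literal list list \<Rightarrow> bool" where
  "basic_data ls d mss \<longleftrightarrow>
     0 \<le> d \<and> ls \<noteq> [] \<and> \<not> inconsistent (set ls) \<and>
     (\<forall>ms \<in> set mss. ms \<noteq> [] \<and> \<not> inconsistent (set ms))"

definition basic_implication :: "gimp \<Rightarrow> bool" where
  "basic_implication \<Phi> \<longleftrightarrow> (\<exists>ls d mss. basic_data ls d mss \<and> \<Phi> = basic_gimp ls d mss)"

definition basic_theory :: "gimp set \<Rightarrow> bool" where
  "basic_theory T \<longleftrightarrow> (\<forall>\<Phi> \<in> T. basic_implication \<Phi>)"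

datatype label = Clause clause | Star

text \<open>A node carries its label and the list of its children, each paired with the weight of the edge
  leading to it. Different nodes may have the same label.\<close>

datatype ptree = Node (label: label) (children: "(real \<times> ptree) list")

type_synonym pforest = "ptree list"

text \<open>Nodes are represented by the subtrees they generate.\<close>

inductive_set nodes :: "pforest \<Rightarrow> ptree set" for F :: pforest where
  root: "t \<in> set F \<Longrightarrow> t \<in> nodes F"
| child: "t \<in> nodes F \<Longrightarrow> (w, s) \<in> set (children t) \<Longrightarrow> s \<in> nodes F"

definition proof_forest :: "pforest \<Rightarrow> bool" where
  "proof_forest F \<longleftrightarrow>
     (\<forall>t \<in> nodes F. (\<forall>L. label t = Clause L \<longrightarrow> is_clause L) \<and>
        (\<forall>(w, s) \<in> set (children t). 0 \<le> w))"

text \<open>\<open>branch t ls ws\<close>: \<open>ls\<close> are the labels and \<open>ws\<close> the edge weights along a path from the root of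
  \<open>t\<close> to a leaf.\<close>

inductive branch :: "ptree \<Rightarrow> label list \<Rightarrow> real list \<Rightarrow> bool" where
  leaf: "branch (Node l []) [l] []"
| step: "(w, t) \<in> set ks \<Longrightarrow> branch t ls ws \<Longrightarrow> branch (Node l ks) (l # ls) (w # ws)"

definition branch_length :: "label list \<Rightarrow> real list \<Rightarrow> real" where
  "branch_length ls ws = (if Star \<in> set ls then 0 else sum_list ws)"

text \<open>Branch lengths are nonnegative, so inserting \<open>0\<close> only serves to give the empty forest
  length \<open>0\<close>.\<close>

definition forest_length :: "pforest \<Rightarrow> real" where
  "forest_length F = Max (insert 0 {branch_length ls ws | t ls ws. t \<in> set F \<and> branch t ls ws})"

definition rule_A :: "gimp set \<Rightarrow> clause \<Rightarrow> real \<Rightarrow> ptree list \<Rightarrow> bool" where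
  "rule_A T L c ts \<longleftrightarrow> c = 0 \<and>
     (\<exists>ls mss. basic_data ls 0 mss \<and> basic_gimp ls 0 mss \<in> T \<and> set ls \<subseteq> L \<and>
        (\<forall>ms \<in> set mss. \<exists>t \<in> set ts. \<exists>L'. label t = Clause L' \<and> L' \<subseteq> set ms \<union> L))"

definition rule_B :: "gimp set \<Rightarrow> clause \<Rightarrow> real \<Rightarrow> ptree list \<Rightarrow> bool" where
  "rule_B T L c ts \<longleftrightarrow> c > 0 \<and>
     (\<exists>ls mss. basic_data ls c mss \<and> basic_gimp ls c mss \<in> T \<and> set ls \<subseteq> L \<and>
        (\<forall>ms \<in> set mss. \<exists>t \<in> set ts. \<exists>L'. label t = Clause L' \<and> L' \<subseteq> set ms))"

definition rule_C :: "clause \<Rightarrow> real \<Rightarrow> ptree list \<Rightarrow> bool" where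
  "rule_C L c ts \<longleftrightarrow> c = 0 \<and> inconsistent L \<and> (\<exists>t. ts = [t] \<and> label t = Star)"

definition rule_D :: "clause \<Rightarrow> real \<Rightarrow> ptree list \<Rightarrow> bool" where
  "rule_D L c ts \<longleftrightarrow> c = 0 \<and>
     (\<exists>p t1 t2 S1 S2. (ts = [t1, t2] \<or> ts = [t2, t1]) \<and> S1 \<subseteq> L \<and> S2 \<subseteq> L \<and>
        label t1 = Clause (insert (Pos p) S1) \<and> label t2 = Clause (insert (Neg p) S2))"

definition forest_proof :: "gimp set \<Rightarrow> pforest \<Rightarrow> form \<Rightarrow> real \<Rightarrow> form \<Rightarrow> bool" where
  "forest_proof T F \<zeta> r \<eta> \<longleftrightarrow>
     proof_forest F \<and>
     (\<exists>B. clause_set_for B \<zeta> \<and>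
        (\<forall>L \<in> B. \<exists>t \<in> set F. \<exists>R. label t = Clause R \<and> R \<subseteq> L)) \<and>
     (\<exists>B. clause_set_for B \<eta> \<and>
        (\<forall>t \<in> nodes F. \<forall>L. label t = Clause L \<and> children t = [] \<longrightarrow> (\<exists>K \<in> B. K \<subseteq> L))) \<and>
     forest_length F \<le> r \<and>
     (\<forall>t \<in> nodes F. \<forall>L. label t = Clause L \<and> children t \<noteq> [] \<longrightarrow>
        (\<exists>c. (\<forall>(w, s) \<in> set (children t). w = c) \<and>
           (let ts = map snd (children t) in
              rule_A T L c ts \<or> rule_B T L c ts \<or> rule_C L c ts \<or> rule_D L c ts)))"

end

theory Submission
  imports Defs
begin

text \<open>
  Say that a clause entails a formula if every valuation making its literals true makes the formula
  true. By induction on the \<open>LAE\<close> proof one shows: if \<open>T \<turnstile> \<alpha> \<Rightarrow>\<^sub>d \<beta>\<close>, then every clause entailing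
  \<open>\<alpha>\<close> is the root of a proof tree of length at most \<open>d\<close> whose terminal clauses entail \<open>\<beta>\<close>. Cut is
  grafting of trees at the leaves; the rule for disjunctions splits on the variables of one
  disjunct by (D) until that disjunct is decided; \<open>R2\<close> holds since along edges of weight \<open>0\<close> the
  clauses may be taken to grow; and \<open>R4\<close> holds since leaves entailing \<open>\<bottom>\<close> are inconsistent and can
  be continued by the star symbol, which makes all branches have length \<open>0\<close>. Finally, the
  full disjunctive normal forms of \<open>\<zeta>\<close> and \<open>\<eta>\<close> serve as the clause sets for (T1) and (T2), after
  splitting the leaves on the variables of \<open>\<eta>\<close>.
\<close>

section \<open>Clauses and valuations\<close>

definition sat :: "(nat \<Rightarrow> bool) \<Rightarrow> clause \<Rightarrow> bool" where
  "sat v L \<longleftrightarrow> (\<forall>l \<in> L. eval v (lit_form l))"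

definition entails :: "clause \<Rightarrow> form \<Rightarrow> bool" where
  "entails L \<alpha> \<longleftrightarrow> (\<forall>v. sat v L \<longrightarrow> eval v \<alpha>)"

lemma sat_Un [simp]: "sat v (L \<union> M) \<longleftrightarrow> sat v L \<and> sat v M"
  by (auto simp: sat_def)

lemma inconsistent_not_sat: "inconsistent L \<Longrightarrow> \<not> sat v L"
  unfolding inconsistent_def sat_def by (metis lit_form.simps eval.simps(1,6))

lemma consistent_sat_Pos: "\<not> inconsistent L \<Longrightarrow> sat (\<lambda>p. Pos p \<in> L) L"
  unfolding sat_def inconsistent_def by (metis lit_form.simps eval.simps(1,6) literal.exhaust)

lemma consistent_sat_Neg: "\<not> inconsistent L \<Longrightarrow> sat (\<lambda>p. Neg p \<notin> L) L"
  unfolding sat_def inconsistent_def by (metis lit_form.simps eval.simps(1,6) literal.exhaust)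

text \<open>Of the models of \<open>L\<close>, one makes every undetermined variable false and
  another makes it true; one of the two refutes any literal missing from \<open>L\<close>.\<close>

lemma consistent_entails_lit:
  assumes "\<not> inconsistent L" and "entails L (lit_form l)"
  shows "l \<in> L"
  using assms consistent_sat_Pos[of L] consistent_sat_Neg[of L]
  by (cases l) (fastforce simp: entails_def)+

lemma eval_conj_list [simp]: "eval v (conj_list \<alpha>s) \<longleftrightarrow> (\<forall>\<alpha> \<in> set \<alpha>s. eval v \<alpha>)"
  by (induction \<alpha>s rule: conj_list.induct) auto

lemma eval_disj_list [simp]: "eval v (disj_list \<alpha>s) \<longleftrightarrow> (\<exists>\<alpha> \<in> set \<alpha>s. eval v \<alpha>)"
  by (induction \<alpha>s rule: disj_list.induct) auto

lemma set_enum_set [simp]: "finite A \<Longrightarrow> set (enum_set A) = A"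
  unfolding enum_set_def using someI_ex[OF finite_distinct_list[of A]] by blast

lemma eval_clause_form: "finite L \<Longrightarrow> eval v (clause_form L) \<longleftrightarrow> sat v L"
  by (auto simp: clause_form_def sat_def)

lemma eval_clause_set_form:
  "is_clause_set B \<Longrightarrow> eval v (clause_set_form B) \<longleftrightarrow> (\<exists>L \<in> B. sat v L)"
  by (auto simp: clause_set_form_def is_clause_set_def is_clause_def eval_clause_form)

section \<open>Diagrams of valuations and full disjunctive normal forms\<close>

primrec vars :: "form \<Rightarrow> nat set" where
  "vars (Var p) = {p}"
| "vars Bot = {}"
| "vars Top = {}"
| "vars (And \<alpha> \<beta>) = vars \<alpha> \<union> vars \<beta>"
| "vars (Or \<alpha> \<beta>) = vars \<alpha> \<union> vars \<beta>"
| "vars (Not \<alpha>) = vars \<alpha>"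

lemma finite_vars [simp]: "finite (vars \<alpha>)"
  by (induction \<alpha>) auto

lemma eval_cong: "(\<And>p. p \<in> vars \<alpha> \<Longrightarrow> v p = w p) \<Longrightarrow> eval v \<alpha> = eval w \<alpha>"
  by (induction \<alpha>) auto

text \<open>For finite \<open>V\<close>, these are the sets of literals collected along the paths of
  a complete splitting on \<open>V\<close> by (D).\<close>

definition diagram :: "(nat \<Rightarrow> bool) \<Rightarrow> nat set \<Rightarrow> clause" where
  "diagram v V = (\<lambda>p. if v p then Pos p else Neg p) ` V"

lemma finite_diagram [simp]: "finite V \<Longrightarrow> finite (diagram v V)"
  by (simp add: diagram_def)

lemma sat_diagram: "sat w (diagram v V) \<longleftrightarrow> (\<forall>p \<in> V. w p = v p)"
  unfolding sat_def diagram_def ball_simps(9)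
  by (rule ball_cong) auto

lemma eval_eq_if_sat_diagram: "sat w (diagram v (vars \<alpha>)) \<Longrightarrow> eval w \<alpha> = eval v \<alpha>"
  by (rule eval_cong) (simp add: sat_diagram)

definition full_dnf :: "form \<Rightarrow> clause set" where
  "full_dnf \<alpha> = {diagram v (vars \<alpha>) | v. eval v \<alpha>}"

text \<open>The valuations are infinitely many, but only literals over the finitely many variables
  of \<open>\<alpha>\<close> occur in their diagrams.\<close>

lemma finite_full_dnf: "finite (full_dnf \<alpha>)"
proof (rule finite_subset)
  show "full_dnf \<alpha> \<subseteq> Pow (Pos ` vars \<alpha> \<union> Neg ` vars \<alpha>)"
    by (auto simp: full_dnf_def diagram_def)
qed simp

lemma finite_in_full_dnf: "L \<in> full_dnf \<alpha> \<Longrightarrow> finite L"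
  by (auto simp: full_dnf_def)

lemma entails_in_full_dnf: "L \<in> full_dnf \<alpha> \<Longrightarrow> entails L \<alpha>"
  by (auto simp: full_dnf_def entails_def eval_eq_if_sat_diagram)

lemma clause_set_for_full_dnf: "clause_set_for (full_dnf \<alpha>) \<alpha>"
proof -
  have cs: "is_clause_set (full_dnf \<alpha>)"
    by (simp add: is_clause_set_def is_clause_def finite_full_dnf finite_in_full_dnf)
  have "(\<exists>L \<in> full_dnf \<alpha>. sat v L) \<longleftrightarrow> eval v \<alpha>" for v
  proof
    assume "eval v \<alpha>"
    then show "\<exists>L \<in> full_dnf \<alpha>. sat v L"
      by (intro bexI[of _ "diagram v (vars \<alpha>)"]) (auto simp: full_dnf_def sat_diagram)
  qed (use entails_in_full_dnf in \<open>auto simp: entails_def\<close>)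
  with cs show ?thesis
    by (simp add: clause_set_for_def bool_equiv_def tautology_def eval_clause_set_form)
qed

section \<open>Derivability of clauses\<close>

text \<open>
  \<open>tree_derivable T Q r L\<close>: a proof tree with root \<open>L\<close> exists all of whose terminal clauses satisfy
  \<open>Q\<close> and all of whose branches without star have length at most \<open>r\<close>. The bound \<open>r\<close> may be
  negative, in which case every branch has to contain a star.
\<close>

inductive tree_derivable :: "gimp set \<Rightarrow> (clause \<Rightarrow> bool) \<Rightarrow> real \<Rightarrow> clause \<Rightarrow> bool"
  for T :: "gimp set" and Q :: "clause \<Rightarrow> bool" where
  leaf: "Q L \<Longrightarrow> 0 \<le> r \<Longrightarrow> tree_derivable T Q r L"
| A: "basic_data ls 0 mss \<Longrightarrow> basic_gimp ls 0 mss \<in> T \<Longrightarrow> set ls \<subseteq> L \<Longrightarrow>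
        (\<And>ms. ms \<in> set mss \<Longrightarrow> tree_derivable T Q r (set ms \<union> L)) \<Longrightarrow> tree_derivable T Q r L"
| B: "0 < c \<Longrightarrow> basic_data ls c mss \<Longrightarrow> basic_gimp ls c mss \<in> T \<Longrightarrow> set ls \<subseteq> L \<Longrightarrow>
        (\<And>ms. ms \<in> set mss \<Longrightarrow> tree_derivable T Q (r - c) (set ms)) \<Longrightarrow> tree_derivable T Q r L"
| C: "inconsistent L \<Longrightarrow> tree_derivable T Q r L"
| D: "tree_derivable T Q r (insert (Pos p) L) \<Longrightarrow> tree_derivable T Q r (insert (Neg p) L) \<Longrightarrow>
        tree_derivable T Q r L"

text \<open>A leaf may be reached with part of \<open>c\<close> unspent, so what is grafted there
  must be available for every bound \<open>s\<close> from \<open>d\<close> upwards.\<close>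

lemma tree_derivable_graft:
  assumes "tree_derivable T Q c L" and "finite L"
    and "\<And>M s. finite M \<Longrightarrow> Q M \<Longrightarrow> d \<le> s \<Longrightarrow> tree_derivable T Q' s M"
  shows "tree_derivable T Q' (c + d) L"
  using assms(1,2)
proof induction
  case (leaf L r)
  then show ?case by (intro assms(3)) auto
next
  case (A ls mss L r)
  show ?case by (rule tree_derivable.A[of ls mss]) (use A in auto)
next
  case (B c ls mss L r)
  show ?case
    by (rule tree_derivable.B[of c ls mss]) (use B in \<open>auto simp: diff_add_eq[symmetric]\<close>)
next
  case (D r p L)
  show ?case by (rule tree_derivable.D[of _ _ _ p]) (use D in auto)
qed (rule tree_derivable.C)

lemma tree_derivable_mono:
  assumes "tree_derivable T Q c L" and "c \<le> d"
    and "\<And>M. Q M \<Longrightarrow> Q' M"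
  shows "tree_derivable T Q' d L"
  using assms(1,2)
proof (induction arbitrary: d)
  case (leaf L r)
  then show ?case using assms(3) by (intro tree_derivable.leaf) auto
next
  case (A ls mss L r)
  show ?case by (rule tree_derivable.A[of ls mss]) (use A in auto)
next
  case (B c ls mss L r)
  show ?case by (rule tree_derivable.B[of c ls mss]) (use B in auto)
next
  case (D r p L)
  show ?case by (rule tree_derivable.D[of _ _ _ p]) (use D in auto)
qed (rule tree_derivable.C)

text \<open>Each leaf is continued by (C), which puts no condition on the bound. Hence
  \<open>d\<close> is arbitrary, even negative, as can happen below an application of (B).\<close>

lemma tree_derivable_inconsistent_leaves:
  assumes "tree_derivable T Q c L" and "\<And>M. Q M \<Longrightarrow> inconsistent M"
  shows "tree_derivable T Q' d L"
  using assms(1)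
proof (induction arbitrary: d)
  case (leaf L r)
  then show ?case using assms(2) by (intro tree_derivable.C) auto
next
  case (A ls mss L r)
  show ?case by (rule tree_derivable.A[of ls mss]) (use A in auto)
next
  case (B c ls mss L r)
  show ?case by (rule tree_derivable.B[of c ls mss]) (use B in auto)
next
  case (D r p L)
  show ?case by (rule tree_derivable.D[of _ _ _ p]) (use D in auto)
qed (rule tree_derivable.C)

text \<open>Bounds never increase towards the leaves and \<open>leaf\<close> demands a nonnegative
  one, so the leaf condition is never consulted.\<close>

lemma tree_derivable_negative:
  assumes "tree_derivable T Q r L" and "r < 0"
  shows "tree_derivable T Q' r L"
  using assms
proof induction
  case (A ls mss L r)
  show ?case by (rule tree_derivable.A[of ls mss]) (use A in auto)
next
  case (B c ls mss L r)
  show ?case by (rule tree_derivable.B[of c ls mss]) (use B in auto)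
next
  case (D r p L)
  show ?case by (rule tree_derivable.D[of _ _ _ p]) (use D in auto)
qed (auto intro: tree_derivable.C)

text \<open>Clauses only grow under (A) and (D). Only (B) forgets the clause of the father, but it
  makes the bound negative, so that all branches below end in a star. The set \<open>K\<close> stays
  fixed while \<open>L\<close> grows.\<close>

lemma tree_derivable_zero_preserves:
  assumes "tree_derivable T Q r L" and "r \<le> 0" and "K \<subseteq> L"
  shows "tree_derivable T (\<lambda>M. Q M \<and> K \<subseteq> M) r L"
  using assms
proof induction
  case (leaf L r)
  then show ?case by (intro tree_derivable.leaf) auto
next
  case (A ls mss L r)
  show ?case by (rule tree_derivable.A[of ls mss]) (use A in auto)
next
  case (B c ls mss L r)
  have "tree_derivable T (\<lambda>M. Q M \<and> K \<subseteq> M) (r - c) (set ms)" if "ms \<in> set mss" for ms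
    by (rule tree_derivable_negative[of T Q]) (use B that in auto)
  with B.hyps(1-4) show ?case by (rule tree_derivable.B)
next
  case (D r p L)
  show ?case by (rule tree_derivable.D[of _ _ _ p]) (use D in auto)
qed (rule tree_derivable.C)

lemma tree_derivable_split:
  assumes "finite V" and "\<And>v. tree_derivable T Q r (diagram v V \<union> L)"
  shows "tree_derivable T Q r L"
  using assms
proof (induction V arbitrary: L)
  case empty
  then show ?case by (simp add: diagram_def)
next
  case (insert p V)
  \<comment> \<open>As \<open>p\<close> is not in \<open>V\<close>, changing \<open>v\<close> at
    \<open>p\<close> leaves the diagram on \<open>V\<close> alone; the literal of \<open>p\<close>
    can be moved into the clause.\<close>
  have extend: "diagram (v(p := b)) (insert p V) \<union> L =
      diagram v V \<union> insert (if b then Pos p else Neg p) L" for v b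
    using insert.hyps by (auto simp: diagram_def)
  have "tree_derivable T Q r (diagram v V \<union> insert (if b then Pos p else Neg p) L)" for v b
    using insert.prems[of "v(p := b)"] unfolding extend .
  then have *: "tree_derivable T Q r (insert (if b then Pos p else Neg p) L)" for b
    by (rule insert.IH)
  show ?case using *[of True] *[of False] by (auto intro: tree_derivable.D)
qed

text \<open>Trades entailment for the inclusion required by (T2). After splitting on the variables
  of \<open>\<alpha>\<close>, a leaf is inconsistent or has a model; in the latter case its diagram
  belongs to the normal form.\<close>

lemma tree_derivable_entails_full_dnf:
  assumes "entails L \<alpha>" and "0 \<le> r"
  shows "tree_derivable T (\<lambda>M. \<exists>K \<in> full_dnf \<alpha>. K \<subseteq> M) r L"
proof (rule tree_derivable_split[OF finite_vars[of \<alpha>]])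
  fix v
  show "tree_derivable T (\<lambda>M. \<exists>K \<in> full_dnf \<alpha>. K \<subseteq> M) r (diagram v (vars \<alpha>) \<union> L)"
  proof (cases "inconsistent (diagram v (vars \<alpha>) \<union> L)")
    case False
    then obtain w where "sat w (diagram v (vars \<alpha>))" and "sat w L"
      using consistent_sat_Pos by fastforce
    then have "eval v \<alpha>"
      using assms(1) eval_eq_if_sat_diagram by (auto simp: entails_def)
    with assms(2) show ?thesis by (intro tree_derivable.leaf) (auto simp: full_dnf_def)
  qed (rule tree_derivable.C)
qed

section \<open>Soundness of the rules of the calculus for trees\<close>

text \<open>Entailment instead of inclusion of clauses makes the notion invariant under Boolean
  equivalence; for \<open>R1\<close> a single node then suffices.\<close>

definition tree_valid :: "gimp set \<Rightarrow> gimp \<Rightarrow> bool" where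
  "tree_valid T \<Phi> \<longleftrightarrow> (case \<Phi> of GImp \<alpha> d \<beta> \<Rightarrow> 0 \<le> d \<and>
     (\<forall>L. finite L \<longrightarrow> entails L \<alpha> \<longrightarrow> tree_derivable T (\<lambda>M. entails M \<beta>) d L))"

lemma tree_valid_GImp:
  "tree_valid T (GImp \<alpha> d \<beta>) \<longleftrightarrow> 0 \<le> d \<and>
     (\<forall>L. finite L \<longrightarrow> entails L \<alpha> \<longrightarrow> tree_derivable T (\<lambda>M. entails M \<beta>) d L)"
  by (simp add: tree_valid_def)

lemma tree_valid_axiom:
  assumes "basic_theory T" and "\<Phi> \<in> T"
  shows "tree_valid T \<Phi>"
proof -
  obtain ls d mss where bd: "basic_data ls d mss" and \<Phi>: "\<Phi> = basic_gimp ls d mss"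
    using assms by (auto simp: basic_theory_def basic_implication_def)
  let ?\<beta> = "disj_list (map (\<lambda>ms. conj_list (map lit_form ms)) mss)"
  have d: "0 \<le> d" using bd by (simp add: basic_data_def)
  \<comment> \<open>\<open>M\<close> will be \<open>L\<close> for (A), which keeps the clause of the
    father, and empty for (B), which drops it.\<close>
  have ent: "entails (set ms \<union> M) ?\<beta>" if "ms \<in> set mss" for ms M
    using that by (auto simp: entails_def sat_def)
  have "tree_derivable T (\<lambda>M. entails M ?\<beta>) d L"
    if L: "entails L (conj_list (map lit_form ls))" for L
  proof (cases "inconsistent L")
    case False
    have sub: "set ls \<subseteq> L"
      using L by (auto intro!: consistent_entails_lit[OF False] simp: entails_def)
    show ?thesis
    proof (cases "d = 0")
      case True
      show ?thesis
        by (rule tree_derivable.A[of ls mss])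
          (use True bd assms(2) \<Phi> sub ent in \<open>auto intro: tree_derivable.leaf\<close>)
    next
      case False
      show ?thesis
        by (rule tree_derivable.B[of d ls mss])
          (use False bd assms(2) \<Phi> sub ent[of _ "{}"] d in \<open>auto intro: tree_derivable.leaf\<close>)
    qed
  qed (rule tree_derivable.C)
  with d show ?thesis by (simp add: \<Phi> basic_gimp_def tree_valid_GImp)
qed

lemma tree_valid_lae_rule:
  assumes "lae_rule P \<Phi>" and P: "\<And>\<Psi>. \<Psi> \<in> P \<Longrightarrow> tree_valid T \<Psi>"
  shows "tree_valid T \<Phi>"
  using assms(1)
proof cases
  case (R1 \<alpha> \<beta>)
  then show ?thesis
    by (auto simp: tree_valid_GImp tautology_def entails_def intro!: tree_derivable.leaf)
next
  case (R2 \<alpha> \<beta> \<gamma>)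
  have "tree_derivable T (\<lambda>M. entails M (And \<beta> \<gamma>)) 0 L"
    if L: "finite L" "entails L (And \<alpha> \<gamma>)" for L
  proof -
    have "tree_derivable T (\<lambda>M. entails M \<beta>) 0 L"
      using P[OF R2(2)] L by (simp add: tree_valid_GImp entails_def)
    \<comment> \<open>Leaves that include \<open>L\<close> still entail \<open>\<gamma>\<close>,
      because \<open>L\<close> does.\<close>
    then have "tree_derivable T (\<lambda>M. entails M \<beta> \<and> L \<subseteq> M) 0 L"
      by (rule tree_derivable_zero_preserves) auto
    then show ?thesis
      by (rule tree_derivable_mono) (use L(2) in \<open>auto simp: entails_def sat_def\<close>)
  qed
  with R2 show ?thesis by (simp add: tree_valid_GImp)
next
  case (R3 \<alpha> c \<beta> d)
  then show ?thesis
    using P[OF R3(2)] by (auto simp: tree_valid_GImp intro: tree_derivable_mono[of T _ c])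
next
  case (R4 \<alpha> c)
  have "inconsistent M" if "entails M Bot" for M
    using that consistent_sat_Pos by (auto simp: entails_def)
  with R4 show ?thesis
    using P[OF R4(2)]
    by (auto simp: tree_valid_GImp intro: tree_derivable_inconsistent_leaves[of T _ c])
next
  case (R5 \<alpha> c \<gamma> \<beta>)
  have "tree_derivable T (\<lambda>M. entails M \<gamma>) c L"
    if L: "finite L" "entails L (Or \<alpha> \<beta>)" for L
  proof (rule tree_derivable_split[OF finite_vars[of \<alpha>]])
    fix v
    let ?M = "diagram v (vars \<alpha>) \<union> L"
    \<comment> \<open>The diagram decides \<open>\<alpha>\<close>: if \<open>v\<close> falsifies
      \<open>\<alpha>\<close>, so does every model of \<open>?M\<close>, and then
      \<open>\<beta>\<close> must hold in it.\<close>
    have "entails ?M \<alpha> \<or> entails ?M \<beta>"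
      using L(2) eval_eq_if_sat_diagram[of _ v \<alpha>] by (auto simp: entails_def)
    moreover have "finite ?M" using L(1) by simp
    ultimately show "tree_derivable T (\<lambda>M. entails M \<gamma>) c ?M"
      using P[OF R5(2)] P[OF R5(3)] by (auto simp: tree_valid_GImp)
  qed
  with R5 show ?thesis by (simp add: tree_valid_GImp)
next
  case (R6 \<alpha> c \<beta> d \<gamma>)
  have "tree_derivable T (\<lambda>M. entails M \<gamma>) (c + d) L" if "finite L" "entails L \<alpha>" for L
  proof (rule tree_derivable_graft)
    show "tree_derivable T (\<lambda>M. entails M \<beta>) c L"
      using P[OF R6(2)] that by (simp add: tree_valid_GImp)
    fix M s assume "finite M" "entails M \<beta>" "d \<le> s"
    then show "tree_derivable T (\<lambda>M. entails M \<gamma>) s M"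
      using P[OF R6(3)] by (auto simp: tree_valid_GImp intro: tree_derivable_mono[of T _ d])
  qed fact
  with R6 show ?thesis by (simp add: tree_valid_GImp)
qed

lemma tree_valid_lae_provable:
  assumes "basic_theory T" and "T \<turnstile> \<Phi>"
  shows "tree_valid T \<Phi>"
proof -
  obtain \<Phi>s where \<Phi>s: "\<Phi>s \<noteq> []" "last \<Phi>s = \<Phi>" "lae_proof T \<Phi>s"
    using assms(2) by (auto simp: lae_provable_def)
  have "tree_valid T (\<Phi>s ! i)" if "i < length \<Phi>s" for i
    using that
  proof (induction i rule: less_induct)
    case (less i)
    then have "tree_valid T \<Psi>" if "\<Psi> \<in> set (take i \<Phi>s)" for \<Psi>
      using that by (auto simp: in_set_conv_nth)
    moreover have "\<Phi>s ! i \<in> T \<or> lae_rule (set (take i \<Phi>s)) (\<Phi>s ! i)"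
      using \<Phi>s(3) less.prems by (auto simp: lae_proof_def)
    ultimately show ?case
      using tree_valid_axiom[OF assms(1)] tree_valid_lae_rule by blast
  qed
  then show ?thesis
    using \<Phi>s(1,2) by (auto simp: last_conv_nth)
qed

section \<open>Construction of proof trees\<close>

lemma nodes_rooted: "s \<in> nodes F \<Longrightarrow> \<exists>t \<in> set F. s \<in> nodes [t]"
proof (induction rule: nodes.induct)
  case (root t)
  then show ?case by (auto intro!: bexI[of _ t] nodes.root)
qed (auto intro: nodes.child)

lemma nodes_Node:
  "s \<in> nodes [Node l ks] \<Longrightarrow> s = Node l ks \<or> (\<exists>(w, t) \<in> set ks. s \<in> nodes [t])"
proof (induction rule: nodes.induct)
  case (child t w s)
  then show ?case by (fastforce intro: nodes.intros)
qed simp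

lemma branch_Node:
  "branch (Node l ks) ls ws \<Longrightarrow> (ks = [] \<and> ls = [l] \<and> ws = []) \<or>
     (\<exists>w t ls' ws'. (w, t) \<in> set ks \<and> branch t ls' ws' \<and> ls = l # ls' \<and> ws = w # ws')"
  by (erule branch.cases) auto

text \<open>Needed because the length of a forest is a \<open>Max\<close>, which can be bounded
  elementwise only over a finite set.\<close>

lemma finite_branches: "finite {(ls, ws). branch t ls ws}"
proof (induction t)
  case (Node l ks)
  let ?S = "\<Union>(w, t) \<in> set ks. (\<lambda>(ls, ws). (l # ls, w # ws)) ` {(ls, ws). branch t ls ws}"
  have "finite ?S"
    using Node by auto
  moreover have "{(ls, ws). branch (Node l ks) ls ws} \<subseteq> insert ([l], []) ?S"
    by (force dest: branch_Node)
  ultimately show ?case by (meson finite.insertI finite_subset)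
qed

text \<open>Gathers all conditions that concern one node and its children: those on a proof forest,
  (T4), and (T2) through \<open>Q\<close>.\<close>

definition good_node :: "gimp set \<Rightarrow> (clause \<Rightarrow> bool) \<Rightarrow> ptree \<Rightarrow> bool" where
  "good_node T Q t \<longleftrightarrow> (\<forall>(w, s) \<in> set (children t). 0 \<le> w) \<and>
     (\<forall>L. label t = Clause L \<longrightarrow> is_clause L \<and>
        (if children t = [] then Q L
         else \<exists>c. (\<forall>(w, s) \<in> set (children t). w = c) \<and>
           (let ts = map snd (children t) in
              rule_A T L c ts \<or> rule_B T L c ts \<or> rule_C L c ts \<or> rule_D L c ts)))"

text \<open>Branches with a star are exempt instead of having length 0, which keeps the bound
  meaningful for negative \<open>r\<close>.\<close>

definition good_tree :: "gimp set \<Rightarrow> (clause \<Rightarrow> bool) \<Rightarrow> real \<Rightarrow> ptree \<Rightarrow> bool" where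
  "good_tree T Q r t \<longleftrightarrow> (\<forall>s \<in> nodes [t]. good_node T Q s) \<and>
     (\<forall>ls ws. branch t ls ws \<longrightarrow> Star \<notin> set ls \<longrightarrow> sum_list ws \<le> r)"

lemma good_tree_Star: "good_tree T Q r (Node Star [])"
  by (auto simp: good_tree_def good_node_def dest!: nodes_Node branch_Node)

lemma good_tree_leaf: "finite L \<Longrightarrow> Q L \<Longrightarrow> 0 \<le> r \<Longrightarrow> good_tree T Q r (Node (Clause L) [])"
  by (auto simp: good_tree_def good_node_def is_clause_def dest!: nodes_Node branch_Node)

text \<open>With \<open>ts\<close> empty the node would be terminal and would have to satisfy
  \<open>Q\<close>.\<close>

lemma good_tree_Node:
  assumes "finite L" and "0 \<le> c" and "ts \<noteq> []" and "\<And>t. t \<in> set ts \<Longrightarrow> good_tree T Q (r - c) t"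
    and "rule_A T L c ts \<or> rule_B T L c ts \<or> rule_C L c ts \<or> rule_D L c ts"
  shows "good_tree T Q r (Node (Clause L) (map (Pair c) ts))"
  unfolding good_tree_def
proof (intro conjI ballI allI impI)
  fix s assume "s \<in> nodes [Node (Clause L) (map (Pair c) ts)]"
  then consider "s = Node (Clause L) (map (Pair c) ts)" | t where "t \<in> set ts" "s \<in> nodes [t]"
    by (auto dest!: nodes_Node)
  then show "good_node T Q s"
  proof cases
    case 1
    have "map snd (map (Pair c) ts) = ts" by (simp add: comp_def)
    then show ?thesis
      using assms(1-3,5) unfolding 1 good_node_def
      by (auto simp: is_clause_def Let_def simp del: map_map)
  next
    case 2
    then show ?thesis using assms(4) by (auto simp: good_tree_def)
  qed
next
  fix ls ws assume "branch (Node (Clause L) (map (Pair c) ts)) ls ws" and "Star \<notin> set ls"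
  then show "sum_list ws \<le> r"
    using assms(3,4) by (fastforce dest!: branch_Node simp: good_tree_def)
qed

text \<open>
  When (A) or (B) is applied, a star is added as a further child, so that the node is non-terminal
  even if the right-hand side of the basic implication is the empty disjunction.
\<close>

lemma good_tree_if_tree_derivable:
  assumes "tree_derivable T Q r L" and "finite L"
  shows "\<exists>t. label t = Clause L \<and> good_tree T Q r t"
  using assms
proof induction
  case (leaf L r)
  then show ?case using good_tree_leaf by (intro exI[of _ "Node (Clause L) []"]) auto
next
  case (A ls mss L r)
  then have "\<forall>ms \<in> set mss. \<exists>t. label t = Clause (set ms \<union> L) \<and> good_tree T Q r t"
    by simp
  then obtain f where f: "\<And>ms. ms \<in> set mss \<Longrightarrow>
      label (f ms) = Clause (set ms \<union> L) \<and> good_tree T Q r (f ms)"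
    by metis
  let ?ts = "Node Star [] # map f mss"
  have "rule_A T L 0 ?ts"
    unfolding rule_A_def using A.hyps(1-3) f by auto
  then have "good_tree T Q r (Node (Clause L) (map (Pair 0) ?ts))"
    using A.prems f good_tree_Star by (intro good_tree_Node) auto
  then show ?case by (metis ptree.sel(1))
next
  case (B c ls mss L r)
  then have "\<forall>ms \<in> set mss. \<exists>t. label t = Clause (set ms) \<and> good_tree T Q (r - c) t"
    by simp
  then obtain f where f: "\<And>ms. ms \<in> set mss \<Longrightarrow>
      label (f ms) = Clause (set ms) \<and> good_tree T Q (r - c) (f ms)"
    by metis
  let ?ts = "Node Star [] # map f mss"
  have "rule_B T L c ?ts"
    unfolding rule_B_def using B.hyps(1-4) f by fastforce
  then have "good_tree T Q r (Node (Clause L) (map (Pair c) ?ts))"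
    using B.prems B.hyps(1) f good_tree_Star by (intro good_tree_Node) auto
  then show ?case by (metis ptree.sel(1))
next
  case (C L r)
  then have "rule_C L 0 [Node Star []]" by (simp add: rule_C_def)
  then have "good_tree T Q r (Node (Clause L) (map (Pair 0) [Node Star []]))"
    using C.prems good_tree_Star by (intro good_tree_Node) auto
  then show ?case by (metis ptree.sel(1))
next
  case (D r p L)
  then obtain t1 t2 where t: "label t1 = Clause (insert (Pos p) L)" "good_tree T Q r t1"
      "label t2 = Clause (insert (Neg p) L)" "good_tree T Q r t2"
    by auto
  have "rule_D L 0 [t1, t2]" unfolding rule_D_def using t by blast
  then have "good_tree T Q r (Node (Clause L) (map (Pair 0) [t1, t2]))"
    using D.prems t by (intro good_tree_Node) auto
  then show ?case by (metis ptree.sel(1))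
qed

section \<open>Assembling trees into a forest proof\<close>

lemma forest_length_le:
  assumes "0 \<le> r" and "\<And>t. t \<in> set F \<Longrightarrow> good_tree T Q r t"
  shows "forest_length F \<le> r"
proof -
  let ?S = "{branch_length ls ws | t ls ws. t \<in> set F \<and> branch t ls ws}"
  have "?S = (\<Union>t \<in> set F. (\<lambda>(ls, ws). branch_length ls ws) ` {(ls, ws). branch t ls ws})"
    by auto
  then have "finite ?S" using finite_branches by simp
  \<comment> \<open>Here branches with a star do count, with length 0, and are covered by
    \<open>0 \<le> r\<close>.\<close>
  moreover have "x \<le> r" if "x \<in> ?S" for x
    using that assms by (auto simp: branch_length_def good_tree_def)
  ultimately show ?thesis using assms(1) by (simp add: forest_length_def)
qed

lemma forest_proof_if_good_trees:
  assumes "0 \<le> r" and good: "\<And>t. t \<in> set F \<Longrightarrow> good_tree T (\<lambda>M. \<exists>K \<in> B. K \<subseteq> M) r t"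
    and "clause_set_for B \<eta>" and "clause_set_for B' \<zeta>"
    and "\<And>L. L \<in> B' \<Longrightarrow> \<exists>t \<in> set F. label t = Clause L"
  shows "forest_proof T F \<zeta> r \<eta>"
proof -
  have node: "good_node T (\<lambda>M. \<exists>K \<in> B. K \<subseteq> M) s" if "s \<in> nodes F" for s
    using nodes_rooted[OF that] good by (auto simp: good_tree_def)
  have "proof_forest F"
    using node by (simp add: proof_forest_def good_node_def)
  moreover have "\<exists>B. clause_set_for B \<zeta> \<and>
      (\<forall>L \<in> B. \<exists>t \<in> set F. \<exists>R. label t = Clause R \<and> R \<subseteq> L)"
    using assms(4,5) by blast
  moreover have "\<exists>B. clause_set_for B \<eta> \<and>
      (\<forall>t \<in> nodes F. \<forall>L. label t = Clause L \<and> children t = [] \<longrightarrow> (\<exists>K \<in> B. K \<subseteq> L))"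
    using assms(3) node by (auto simp: good_node_def)
  moreover have "forest_length F \<le> r"
    using assms(1) good by (rule forest_length_le)
  moreover have "\<forall>t \<in> nodes F. \<forall>L. label t = Clause L \<and> children t \<noteq> [] \<longrightarrow>
      (\<exists>c. (\<forall>(w, s) \<in> set (children t). w = c) \<and>
         (let ts = map snd (children t) in
            rule_A T L c ts \<or> rule_B T L c ts \<or> rule_C L c ts \<or> rule_D L c ts))"
    using node unfolding good_node_def by metis
  ultimately show ?thesis unfolding forest_proof_def by blast
qed

theorem theorem3p9:
  fixes T :: "gimp set" and \<zeta> \<eta> :: form and r :: real
  assumes "basic_theory T"
    and "0 \<le> r"
    and "T \<turnstile> GImp \<zeta> r \<eta>"
  shows "\<exists>F. forest_proof T F \<zeta> r \<eta>"
proof -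
  let ?Q = "\<lambda>M. \<exists>K \<in> full_dnf \<eta>. K \<subseteq> M"
  have "\<exists>t. label t = Clause L \<and> good_tree T ?Q r t" if L: "L \<in> full_dnf \<zeta>" for L
  proof -
    have "tree_derivable T (\<lambda>M. entails M \<eta>) r L"
      using tree_valid_lae_provable[OF assms(1,3)] finite_in_full_dnf[OF L] entails_in_full_dnf[OF L]
      by (simp add: tree_valid_GImp)
    \<comment> \<open>The splittings grafted at the leaves use only edges of weight 0, so they add
      nothing to the bound.\<close>
    then have "tree_derivable T ?Q (r + 0) L"
      by (rule tree_derivable_graft)
        (use finite_in_full_dnf[OF L] tree_derivable_entails_full_dnf in auto)
    then show ?thesis
      using good_tree_if_tree_derivable finite_in_full_dnf[OF L] by simp
  qed
  then obtain f where f: "\<And>L. L \<in> full_dnf \<zeta> \<Longrightarrow> label (f L) = Clause L \<and> good_tree T ?Q r (f L)"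
    by metis
  obtain Ls where Ls: "set Ls = full_dnf \<zeta>"
    using finite_list[OF finite_full_dnf] by blast
  have "forest_proof T (map f Ls) \<zeta> r \<eta>"
    by (rule forest_proof_if_good_trees[OF assms(2) _ clause_set_for_full_dnf clause_set_for_full_dnf])
      (use f Ls in auto)
  then show ?thesis ..
qed

end
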